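(* Let $H$ be an $m$-uniform connected hypergraph ($m\ge2$, with at least one edge) on $n$ vertices, with an associated dual tensor $\mathcal{A}=\mathcal{A}_s+\mathcal{A}_d\epsilon$ of order $m$ and dimension $n$, where $\mathcal{A}_s$ is the adjacency tensor of $H$ (and $\mathcal{A}_d$ is a real tensor). Then $\mathcal{A}$ has a positive dual number eigenvalue $\lambda=\lambda_s+\lambda_d\epsilon$ with a positive dual eigenvector $x=x_s+x_d\epsilon$. Furthermore, $\lambda_s,\lambda_d,x_s,x_d$ have the following properties. (1) $\lambda_s$ is the spectral radius of $\mathcal{A}_s$, $\mathcal{A}_sx_s^{m-1}=\lambda_sx_s^{[m-1]}$, and $\lambda_d=\dfrac{x_s^\top(\mathcal{A}_dx_s^{m-1})}{\|x_s\|_m^m}$. (2) $M(H,x_s)$ is an irreducible singular $M$-matrix such that ${\rm Ker}(M(H,x_s))=\{cx_s:c\in\mathbb{R}\}$. (3) Let $M^{(1)}$ be a $\{1\}$-inverse of $M(H,x_s)$. Then $$x_d\in S=\{M^{(1)}(\mathcal{A}_d-\lambda_d\mathcal{I})x_s^{m-1}+cx_s:c\in\mathbb{R}\},$$ and for any $z\in S$, $x_s+z\epsilon$ is an eigenvector of the eigenvalue $\lambda$ of $\mathcal{A}$. (4) If $x_s^\top x_d=0$, then $x_d=M(H,x_s)^\#(\mathcal{A}_d-\lambda_d\mathcal{I})x_s^{m-1}$.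
   Context: Dual numbers: $\mathbb{D}=\{a_s+a_d\epsilon: a_s,a_d\in\mathbb{R}\}$ with $\epsilon\ne0$, $\epsilon^2=0$, $\epsilon$ commuting with reals; $a_s,a_d$ are the standard and dual parts. A dual vector is $x=x_s+x_d\epsilon$ with $x_s,x_d\in\mathbb{R}^n$; a dual tensor of order $m$ and dimension $n$ is $\mathcal{A}=\mathcal{A}_s+\mathcal{A}_d\epsilon$ with $\mathcal{A}_s,\mathcal{A}_d$ real $n\times\cdots\times n$ ($m$ indices) arrays. A dual number $\lambda$ is positive if $\lambda_s>0$; a dual vector $x$ is positive if all entries of $x_s$ are positive. For a (real, complex or dual) tensor $\mathcal{A}=(a_{i_1\cdots i_m})$ and vector $x$, $\mathcal{A}x^{m-1}$ is the vector with $i$-th entry $\sum_{i_2,\ldots,i_m=1}^n a_{ii_2\cdots i_m}x_{i_2}\cdots x_{i_m}$, and $x^{[m-1]}=(x_1^{m-1},\ldots,x_n^{m-1})^\top$. A dual number $\lambda$ is an eigenvalue of the dual tensor $\mathcal{A}$ with eigenvector $x=x_s+x_d\epsilon\in\mathbb{D}^n$ if $x_s\neq0$ and $\mathcal{A}x^{m-1}=\lambda x^{[m-1]}$. For a complex tensor, eigenvalues are those $\lambda\in\mathbb{C}$ for which $\mathcal{A}x^{m-1}=\lambda x^{[m-1]}$ for some nonzero $x\in\mathbb{C}^n$; the spectral radius is the largest modulus of an eigenvalue. $\mathcal{I}$ is the diagonal tensor of order $m$ and dimension $n$ with all diagonal entries $1$ (so $\mathcal{I}x^{m-1}=x^{[m-1]}$).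 In an $m$-uniform hypergraph $H$ with vertex set $\{1,\ldots,n\}$, every edge is a set of $m$ distinct vertices. Its adjacency tensor has entries $a_{i_1\cdots i_m}=\frac{1}{(m-1)!}$ if $\{i_1,\ldots,i_m\}\in E(H)$ and $0$ otherwise. For a vertex subset $U$, $x_s^U=\prod_{i\in U}(x_s)_i$ (empty product $=1$). $M(H,x_s)$ is the $n\times n$ symmetric matrix with entries $$(M(H,x_s))_{uv}=\begin{cases}(m-1)\lambda_s(x_s)_u^{m-2}&\text{if }u=v,\\ -\sum_{\{u,v\}\subseteq e\in E(H)}x_s^{e\setminus\{u,v\}}&\text{if }u\sim v,\\ 0&\text{otherwise,}\end{cases}$$ where $u\sim v$ means that some edge contains the two distinct vertices $u$ and $v$. $\|x_s\|_m=(\sum_i |(x_s)_i|^m)^{1/m}$. A $Z$-matrix is a real square matrix with nonpositive off-diagonal entries; an $M$-matrix is a $Z$-matrix of the form $sI-B$ with $B$ entrywise nonnegative and $s\ge\rho(B)$ ($\rho$ the spectral radius). A square matrix is irreducible if the digraph of its nonzero off-diagonal entries is strongly connected. ${\rm Ker}(M)=\{v\in\mathbb{R}^n:Mv=0\}$. A $\{1\}$-inverse of $M$ is any real matrix $X$ with $MXM=M$. The group inverse $M^\#$ is the unique matrix $X$ with $MXM=M$, $XMX=X$, $MX=XM$ (it exists iff ${\rm rank}(M)={\rm rank}(M^2)$). *)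

theory Defs
  imports "HOL-Analysis.Analysis"
begin

section \<open>Dual numbers\<close>

datatype dualnum = Dual (std_part: real) (dual_part: real)

instantiation dualnum :: comm_ring_1
begin

definition "0 = Dual 0 0"
definition "1 = Dual 1 0"
definition "- a = Dual (- std_part a) (- dual_part a)"
definition "a + b = Dual (std_part a + std_part b) (dual_part a + dual_part b)"
definition "a - b = Dual (std_part a - std_part b) (dual_part a - dual_part b)"
definition "a * b = Dual (std_part a * std_part b)
                         (std_part a * dual_part b + dual_part a * std_part b)"

instance
  by standard
    (auto simp: zero_dualnum_def one_dualnum_def uminus_dualnum_def plus_dualnum_def
       minus_dualnum_def times_dualnum_def algebra_simps dualnum.expand)

end

definition dual_eps :: dualnum
  where "dual_eps = Dual 0 1"

lemma dual_eps_nonzero: "dual_eps \<noteq> 0"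
  by (simp add: dual_eps_def zero_dualnum_def)

lemma dual_eps_square: "dual_eps ^ 2 = 0"
  by (simp add: dual_eps_def zero_dualnum_def times_dualnum_def power2_eq_square)

lemma Dual_eq_std_plus_eps: "Dual a b = Dual a 0 + Dual b 0 * dual_eps"
  by (simp add: dual_eps_def plus_dualnum_def times_dualnum_def)

definition dual_vec :: "real ^ 'n \<Rightarrow> real ^ 'n \<Rightarrow> dualnum ^ 'n"
  where "dual_vec xs xd = (\<chi> i. Dual (xs $ i) (xd $ i))"

definition dual_pos :: "dualnum \<Rightarrow> bool"
  where "dual_pos a \<longleftrightarrow> std_part a > 0"

definition dual_vec_pos :: "dualnum ^ 'n \<Rightarrow> bool"
  where "dual_vec_pos x \<longleftrightarrow> (\<forall>i. std_part (x $ i) > 0)"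


section \<open>Tensors and their eigenvalues\<close>

text \<open>A tensor of order m and dimension CARD('n) is a function on index lists; only its
  values on lists of length m are ever used.\<close>

type_synonym ('a, 'n) tensor = "'n list \<Rightarrow> 'a"

definition dual_tensor :: "(real, 'n) tensor \<Rightarrow> (real, 'n) tensor \<Rightarrow> (dualnum, 'n) tensor"
  where "dual_tensor As Ad = (\<lambda>is. Dual (As is) (Ad is))"

definition tensor_apply ::
    "nat \<Rightarrow> ('a::comm_semiring_1, 'n::finite) tensor \<Rightarrow> 'a ^ 'n \<Rightarrow> 'a ^ 'n"
  where "tensor_apply m A x =
    (\<chi> i. \<Sum>is | length is = m - 1. A (i # is) * (\<Prod>j\<leftarrow>is. x $ j))"

definition vec_power :: "'a::monoid_mult ^ 'n \<Rightarrow> nat \<Rightarrow> 'a ^ 'n"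
  where "vec_power x k = (\<chi> i. x $ i ^ k)"

definition unit_tensor :: "(real, 'n) tensor"
  where "unit_tensor is = (if \<exists>i. set is = {i} then 1 else 0)"

definition dual_eigenpair ::
    "nat \<Rightarrow> (dualnum, 'n::finite) tensor \<Rightarrow> dualnum \<Rightarrow> dualnum ^ 'n \<Rightarrow> bool"
  where "dual_eigenpair m A ev x \<longleftrightarrow>
    (\<chi> i. std_part (x $ i)) \<noteq> 0 \<and> tensor_apply m A x = ev *s vec_power x (m - 1)"

definition tensor_eigenvalues :: "nat \<Rightarrow> (complex, 'n::finite) tensor \<Rightarrow> complex set"
  where "tensor_eigenvalues m A =
    {ev. \<exists>x. x \<noteq> 0 \<and> tensor_apply m A x = ev *s vec_power x (m - 1)}"

text \<open>A relation rather than a Max or Sup: it carries the claim that the largest modulus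
  exists and is attained.\<close>

definition is_largest_modulus :: "complex set \<Rightarrow> real \<Rightarrow> bool"
  where "is_largest_modulus S r \<longleftrightarrow> (\<exists>ev\<in>S. cmod ev = r) \<and> (\<forall>ev\<in>S. cmod ev \<le> r)"

definition is_tensor_spectral_radius :: "nat \<Rightarrow> (real, 'n::finite) tensor \<Rightarrow> real \<Rightarrow> bool"
  where "is_tensor_spectral_radius m A r \<longleftrightarrow>
    is_largest_modulus (tensor_eigenvalues m (\<lambda>is. complex_of_real (A is))) r"

definition m_norm :: "nat \<Rightarrow> real ^ 'n::finite \<Rightarrow> real"
  where "m_norm m x = root m (\<Sum>i\<in>UNIV. \<bar>x $ i\<bar> ^ m)"


section \<open>Matrices\<close>

definition matrix_eigenvalues :: "complex ^ 'n ^ 'n::finite \<Rightarrow> complex set"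
  where "matrix_eigenvalues B = {ev. \<exists>v. v \<noteq> 0 \<and> B *v v = ev *s v}"

definition is_matrix_spectral_radius :: "real ^ 'n ^ 'n::finite \<Rightarrow> real \<Rightarrow> bool"
  where "is_matrix_spectral_radius B r \<longleftrightarrow>
    is_largest_modulus (matrix_eigenvalues (\<chi> i j. complex_of_real (B $ i $ j))) r"

definition Z_matrix :: "real ^ 'n ^ 'n \<Rightarrow> bool"
  where "Z_matrix M \<longleftrightarrow> (\<forall>i j. i \<noteq> j \<longrightarrow> M $ i $ j \<le> 0)"

definition M_matrix :: "real ^ 'n ^ 'n::finite \<Rightarrow> bool"
  where "M_matrix M \<longleftrightarrow> Z_matrix M \<and>
    (\<exists>s B r. M = s *\<^sub>R mat 1 - B \<and> (\<forall>i j. 0 \<le> B $ i $ j) \<and>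
             is_matrix_spectral_radius B r \<and> r \<le> s)"

definition irreducible_matrix :: "real ^ 'n ^ 'n \<Rightarrow> bool"
  where "irreducible_matrix M \<longleftrightarrow>
    (\<forall>u v. (\<lambda>i j. i \<noteq> j \<and> M $ i $ j \<noteq> 0)\<^sup>*\<^sup>* u v)"

definition is_one_inverse :: "real ^ 'n ^ 'n::finite \<Rightarrow> real ^ 'n ^ 'n \<Rightarrow> bool"
  where "is_one_inverse M X \<longleftrightarrow> M ** X ** M = M"

definition is_group_inverse :: "real ^ 'n ^ 'n::finite \<Rightarrow> real ^ 'n ^ 'n \<Rightarrow> bool"
  where "is_group_inverse M X \<longleftrightarrow>
    M ** X ** M = M \<and> X ** M ** X = X \<and> M ** X = X ** M"

text \<open>Unspecified if M has no group inverse.\<close>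

definition group_inverse :: "real ^ 'n ^ 'n::finite \<Rightarrow> real ^ 'n ^ 'n"
  where "group_inverse M = (THE X. is_group_inverse M X)"


section \<open>Hypergraphs\<close>

text \<open>A hypergraph with vertex set UNIV :: 'n set is given by its set of edges.\<close>

definition uniform_hypergraph :: "nat \<Rightarrow> 'n set set \<Rightarrow> bool"
  where "uniform_hypergraph m E \<longleftrightarrow> (\<forall>e\<in>E. card e = m)"

definition hyper_adj :: "'n set set \<Rightarrow> 'n \<Rightarrow> 'n \<Rightarrow> bool"
  where "hyper_adj E u v \<longleftrightarrow> u \<noteq> v \<and> (\<exists>e\<in>E. {u, v} \<subseteq> e)"

definition connected_hypergraph :: "'n set set \<Rightarrow> bool"
  where "connected_hypergraph E \<longleftrightarrow> (\<forall>u v. (hyper_adj E)\<^sup>*\<^sup>* u v)"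

definition adjacency_tensor :: "nat \<Rightarrow> 'n set set \<Rightarrow> (real, 'n) tensor"
  where "adjacency_tensor m E is = (if set is \<in> E then 1 / fact (m - 1) else 0)"

definition hyper_matrix ::
    "nat \<Rightarrow> 'n set set \<Rightarrow> real \<Rightarrow> real ^ 'n \<Rightarrow> real ^ 'n ^ 'n::finite"
  where "hyper_matrix m E ls xs = (\<chi> u v.
    if u = v then real (m - 1) * ls * (xs $ u) ^ (m - 2)
    else if hyper_adj E u v then
      - (\<Sum>e | e \<in> E \<and> {u, v} \<subseteq> e. \<Prod>i\<in>e - {u, v}. xs $ i)
    else 0)"

end

theory Submission
  imports Defs "HOL-Combinatorics.Multiset_Permutations"
begin

text \<open>Write L x u for the sum over the edges e at u of the product of x over e - {u}; it is the
  adjacency tensor applied to x. The derivative of x \<mapsto> l x^[m-1] - L x is the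
  matrix M(H,x), so the dual part of the eigenvalue equation is the linear system
  M xd = Ad x^(m-1) - ld x^[m-1], and homogeneity gives M x = 0. As M is a symmetric irreducible
  Z-matrix annihilating a positive vector, comparing ratios v i / x i shows that its kernel is
  spanned by x. So the system is solvable iff its right-hand side is orthogonal to x, which
  determines ld. A group inverse of M comes from the inverse of the invertible matrix M + x x^T.
  A positive eigenvector of the adjacency tensor is a maximizer of the edge polynomial on the
  nonnegative part of the unit sphere of the m-norm.\<close>

section \<open>The adjacency tensor and dual eigenpairs\<close>

text \<open>Taken over a commutative semiring because it is evaluated at real, complex and dual
  vectors alike.\<close>

definition link_sum :: "'n set set \<Rightarrow> 'a::comm_semiring_1 ^ 'n \<Rightarrow> 'n \<Rightarrow> 'a"
  where "link_sum E x u = (\<Sum>e | e \<in> E \<and> u \<in> e. \<Prod>j\<in>e - {u}. x $ j)"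

text \<open>For \<open>v \<noteq> u\<close>, the formal partial derivative of
  \<open>link_sum E x u\<close> in the coordinate \<open>x $ v\<close>.\<close>

definition pair_sum :: "'n set set \<Rightarrow> 'a::comm_semiring_1 ^ 'n \<Rightarrow> 'n \<Rightarrow> 'n \<Rightarrow> 'a"
  where "pair_sum E x u v = (\<Sum>e | e \<in> E \<and> {u, v} \<subseteq> e. \<Prod>j\<in>e - {u, v}. x $ j)"

lemma finite_lists_of_length: "finite {is :: 'n::finite list. length is = k}"
  using finite_lists_length_eq[of "UNIV :: 'n set" k] by simp

text \<open>A list with only \<open>m - 1\<close> entries that has to cover the \<open>m - 1\<close>
  vertices of \<open>e - {u}\<close> has no room for a repetition or for \<open>u\<close>
  itself.\<close>

lemma lists_completing_edge:
  assumes "finite e" "u \<in> e" "card e = m"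
  shows "{is. length is = m - 1 \<and> set (u # is) = e} = permutations_of_set (e - {u})"
proof (intro set_eqI iffI)
  fix "is" assume "is \<in> {is. length is = m - 1 \<and> set (u # is) = e}"
  then have l: "length is = m - 1" and s: "insert u (set is) = e" by auto
  have c: "card (e - {u}) = m - 1" using assms by simp
  have sub: "e - {u} \<subseteq> set is" using s by auto
  have "card (set is) \<le> m - 1" using l card_length[of "is"] by simp
  then have eq: "e - {u} = set is" using sub c by (intro card_seteq) auto
  then have "distinct is" using l c by (simp add: card_distinct)
  then show "is \<in> permutations_of_set (e - {u})" using eq by (simp add: permutations_of_set_def)
next
  fix "is" assume "is \<in> permutations_of_set (e - {u})"
  then show "is \<in> {is. length is = m - 1 \<and> set (u # is) = e}"
    using assms by (auto simp: permutations_of_set_def distinct_card[symmetric] card_Diff_singleton)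
qed

text \<open>Grouping the index lists by the edge they complete, each edge at \<open>u\<close> occurs
  \<open>fact (m - 1)\<close> times with one and the same product, and \<open>c\<close> cancels this
  factor. The scalar is abstract so that real, complex and dual entries are all covered.\<close>

lemma tensor_apply_adjacency:
  fixes x :: "'a::comm_semiring_1 ^ 'n::finite"
  assumes "uniform_hypergraph m E"
    and A: "\<And>is. A is = (if set is \<in> E then c else 0)"
    and c: "c * of_nat (fact (m - 1)) = 1"
  shows "tensor_apply m A x $ u = link_sum E x u"
proof -
  let ?L = "{is :: 'n list. length is = m - 1}" and ?E = "{e \<in> E. u \<in> e}"
  have fin: "finite ?L" by (rule finite_lists_of_length)
  have "tensor_apply m A x $ u = (\<Sum>is\<in>?L. A (u # is) * (\<Prod>j\<leftarrow>is. x $ j))"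
    by (simp add: tensor_apply_def)
  \<comment> \<open>The inner sum has at most one nonzero term, at \<open>e = set (u # is)\<close>;
    it is introduced so that the two sums can be swapped.\<close>
  also have "\<dots> = (\<Sum>is\<in>?L. \<Sum>e\<in>?E. if set (u # is) = e then c * (\<Prod>j\<leftarrow>is. x $ j) else 0)"
    by (intro sum.cong refl) (auto simp: A)
  also have "\<dots> = (\<Sum>e\<in>?E. \<Sum>is\<in>?L. if set (u # is) = e then c * (\<Prod>j\<leftarrow>is. x $ j) else 0)"
    by (rule sum.swap)
  also have "\<dots> = (\<Sum>e\<in>?E. \<Prod>j\<in>e - {u}. x $ j)"
  proof (rule sum.cong[OF refl])
    fix e assume e: "e \<in> ?E"
    then have ce: "card e = m" using assms(1) by (auto simp: uniform_hypergraph_def)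
    have "(\<Sum>is\<in>?L. if set (u # is) = e then c * (\<Prod>j\<leftarrow>is. x $ j) else 0)
      = (\<Sum>is | length is = m - 1 \<and> set (u # is) = e. c * (\<Prod>j\<leftarrow>is. x $ j))"
      using sum.inter_filter[OF fin, of "\<lambda>is. c * (\<Prod>j\<leftarrow>is. x $ j)" "\<lambda>is. set (u # is) = e"] by simp
    also have "\<dots> = (\<Sum>is\<in>permutations_of_set (e - {u}). c * (\<Prod>j\<in>e - {u}. x $ j))"
      using lists_completing_edge[OF _ _ ce, of u] e
      by (intro sum.cong) (auto simp: permutations_of_set_def prod.distinct_set_conv_list[symmetric])
    also have "\<dots> = (c * of_nat (fact (m - 1))) * (\<Prod>j\<in>e - {u}. x $ j)"
      using e ce by (simp add: card_Diff_singleton algebra_simps)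
    finally show "(\<Sum>is\<in>?L. if set (u # is) = e then c * (\<Prod>j\<leftarrow>is. x $ j) else 0)
      = (\<Prod>j\<in>e - {u}. x $ j)" by (simp only: c mult_1_left)
  qed
  finally show ?thesis by (simp add: link_sum_def)
qed

lemma tensor_apply_unit_tensor:
  fixes x :: "real ^ 'n::finite"
  shows
  "tensor_apply m unit_tensor x = vec_power x (m - 1)"
proof (subst vec_eq_iff, rule allI)
  fix u :: 'n
  have 1: "unit_tensor (u # is) = (if is = replicate (length is) u then 1 else 0)" for "is"
  proof -
    have "(\<exists>i. set (u # is) = {i}) \<longleftrightarrow> is = replicate (length is) u"
      by (metis insert_iff list.set_intros(1) list.simps(15) replicate_eqI set_replicate_Suc
        replicate_Suc singletonD)
    then show ?thesis by (simp only: unit_tensor_def)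
  qed
  have "tensor_apply m unit_tensor x $ u
    = (\<Sum>is | length is = m - 1. if is = replicate (m - 1) u then \<Prod>j\<leftarrow>is. x $ j else 0)"
    by (auto simp: tensor_apply_def 1 intro!: sum.cong)
  also have "\<dots> = vec_power x (m - 1) $ u"
    by (simp add: finite_lists_of_length vec_power_def)
  finally show "tensor_apply m unit_tensor x $ u = vec_power x (m - 1) $ u" .
qed

lemma tensor_apply_diff_scaled:
  fixes A B :: "(real, 'n::finite) tensor"
  shows "tensor_apply m (\<lambda>is. A is - c * B is) x = tensor_apply m A x - c *s tensor_apply m B x"
  by (simp add: vec_eq_iff tensor_apply_def sum_subtractf sum_distrib_left algebra_simps)

section \<open>Arithmetic of dual numbers\<close>

lemma Dual_mult: "Dual a b * Dual c d = Dual (a * c) (a * d + b * c)"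
  by (simp add: times_dualnum_def)

lemma Dual_add: "Dual a b + Dual c d = Dual (a + c) (b + d)"
  by (simp add: plus_dualnum_def)

lemma Dual_sum: "(\<Sum>i\<in>I. Dual (a i) (b i)) = Dual (\<Sum>i\<in>I. a i) (\<Sum>i\<in>I. b i)"
  by (induction I rule: infinite_finite_induct) (auto simp: zero_dualnum_def Dual_add)

lemma Dual_of_nat: "of_nat k = Dual (of_nat k) 0"
  by (induction k) (auto simp: zero_dualnum_def one_dualnum_def Dual_add)

text \<open>As \<open>dual_eps\<close> squares to zero, the dual part obeys the rule for derivatives
  of powers. At \<open>k = 0\<close> the truncated \<open>k - 1\<close> is harmless, since the
  factor \<open>real k\<close> vanishes.\<close>

lemma Dual_power: "Dual a b ^ k = Dual (a ^ k) (real k * a ^ (k - 1) * b)"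
proof (induction k)
  case (Suc k)
  then show ?case by (cases k) (auto simp: Dual_mult algebra_simps)
qed (simp add: one_dualnum_def)

text \<open>The product rule: only terms with at most one dual factor survive.\<close>

lemma Dual_prod:
  assumes "finite I"
  shows "(\<Prod>i\<in>I. Dual (a i) (b i)) = Dual (\<Prod>i\<in>I. a i) (\<Sum>i\<in>I. b i * (\<Prod>j\<in>I - {i}. a j))"
  using assms
proof (induction I rule: finite_induct)
  case (insert k I)
  have "(\<Sum>i\<in>I. b i * (\<Prod>j\<in>insert k I - {i}. a j)) = (\<Sum>i\<in>I. a k * (b i * (\<Prod>j\<in>I - {i}. a j)))"
  proof (rule sum.cong[OF refl])
    fix i assume i: "i \<in> I"
    then have "insert k I - {i} = insert k (I - {i})" using insert by auto
    then show "b i * (\<Prod>j\<in>insert k I - {i}. a j) = a k * (b i * (\<Prod>j\<in>I - {i}. a j))"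
      using insert by simp
  qed
  then show ?case using insert
    by (simp add: Dual_mult sum_distrib_left insert_Diff_if algebra_simps)
qed (simp add: one_dualnum_def)

lemma std_part_prod_list:
  "std_part (\<Prod>j\<leftarrow>is. Dual (a j) (b j)) = (\<Prod>j\<leftarrow>is. a j)"
  by (induction "is") (auto simp: one_dualnum_def times_dualnum_def)

section \<open>The linearized eigenvalue equation and its matrix\<close>

text \<open>Double counting of pairs of an edge at \<open>u\<close> and another vertex
  \<open>v\<close> of it. The left side is the derivative of \<open>link_sum E x u\<close> in
  direction \<open>y\<close>; the case \<open>y = x\<close> later gives Euler's identity.\<close>

lemma sum_link_pair:
  fixes x y :: "'a::comm_semiring_1 ^ 'n::finite"
  shows "(\<Sum>e | e \<in> E \<and> u \<in> e. \<Sum>v\<in>e - {u}. y $ v * (\<Prod>j\<in>e - {u} - {v}. x $ j))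
    = (\<Sum>v\<in>UNIV - {u}. pair_sum E x u v * y $ v)"
proof -
  have "(\<Sum>e | e \<in> E \<and> u \<in> e. \<Sum>v\<in>e - {u}. y $ v * (\<Prod>j\<in>e - {u} - {v}. x $ j))
    = (\<Sum>e | e \<in> E \<and> u \<in> e. \<Sum>v | v \<in> UNIV - {u} \<and> v \<in> e. y $ v * (\<Prod>j\<in>e - {u, v}. x $ j))"
    by (intro sum.cong refl) (auto simp: Diff_insert2[symmetric] insert_commute intro!: prod.cong)
  also have "\<dots> = (\<Sum>v\<in>UNIV - {u}. \<Sum>e | e \<in> {e \<in> E. u \<in> e} \<and> v \<in> e. y $ v * (\<Prod>j\<in>e - {u, v}. x $ j))"
    using sum.swap_restrict[of "{e \<in> E. u \<in> e}" "UNIV - {u}"] by simp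
  also have "\<dots> = (\<Sum>v\<in>UNIV - {u}. pair_sum E x u v * y $ v)"
    by (intro sum.cong refl) (auto simp: pair_sum_def sum_distrib_left sum_distrib_right mult.commute
      conj_assoc)
  finally show ?thesis .
qed

text \<open>For non-adjacent vertices no edge contains both, so the sum is empty and the case
  distinction disappears.\<close>

lemma hyper_matrix_off_diagonal:
  assumes "u \<noteq> v"
  shows "hyper_matrix m E ls x $ u $ v = - pair_sum E x u v"
proof -
  have "{e \<in> E. {u, v} \<subseteq> e} = {}" if "\<not> hyper_adj E u v"
    using that assms by (auto simp: hyper_adj_def)
  then have "pair_sum E x u v = 0" if "\<not> hyper_adj E u v"
    using that unfolding pair_sum_def by (metis sum.empty)
  then show ?thesis using assms by (auto simp: hyper_matrix_def pair_sum_def)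
qed

lemma hyper_matrix_mult:
  "(hyper_matrix m E ls x *v y) $ u
    = real (m - 1) * ls * x $ u ^ (m - 2) * y $ u - (\<Sum>v\<in>UNIV - {u}. pair_sum E x u v * y $ v)"
proof -
  have "(hyper_matrix m E ls x *v y) $ u = (\<Sum>v\<in>UNIV. hyper_matrix m E ls x $ u $ v * y $ v)"
    by (simp add: matrix_vector_mult_def)
  also have "\<dots> = hyper_matrix m E ls x $ u $ u * y $ u
      + (\<Sum>v\<in>UNIV - {u}. hyper_matrix m E ls x $ u $ v * y $ v)"
    by (simp add: sum.remove)
  also have "(\<Sum>v\<in>UNIV - {u}. hyper_matrix m E ls x $ u $ v * y $ v)
      = - (\<Sum>v\<in>UNIV - {u}. pair_sum E x u v * y $ v)"
    by (simp add: hyper_matrix_off_diagonal sum_negf[symmetric])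
  finally show ?thesis by (simp add: hyper_matrix_def)
qed

lemma tensor_apply_adjacency_real:
  assumes "uniform_hypergraph m E"
  shows "tensor_apply m (adjacency_tensor m E) x $ u = link_sum E x u"
  using assms by (rule tensor_apply_adjacency) (auto simp: adjacency_tensor_def)

text \<open>The tensor is split into the adjacency part, evaluated over the dual numbers by the
  product rule, and the purely dual part \<open>Ad\<close>.\<close>

lemma tensor_apply_dual_adjacency:
  assumes "uniform_hypergraph m E"
  shows "tensor_apply m (dual_tensor (adjacency_tensor m E) Ad) (dual_vec x y) $ u
    = Dual (link_sum E x u)
        ((\<Sum>v\<in>UNIV - {u}. pair_sum E x u v * y $ v) + tensor_apply m Ad x $ u)"
proof -
  let ?c = "Dual (1 / fact (m - 1)) 0"
  let ?A = "\<lambda>is. if set is \<in> E then ?c else 0"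
  let ?P = "\<lambda>is. \<Prod>j\<leftarrow>is. dual_vec x y $ j"
  \<comment> \<open>A purely dual factor annihilates the dual part of the other one, so
    \<open>Ad\<close> only meets the standard part \<open>x\<close>.\<close>
  have "Dual 0 (Ad is) * ?P is' = Dual 0 (Ad is * (\<Prod>j\<leftarrow>is'. x $ j))" for "is" is'
    using std_part_prod_list[of "\<lambda>j. x $ j" "\<lambda>j. y $ j" is']
    by (simp add: times_dualnum_def dual_vec_def)
  moreover have "dual_tensor (adjacency_tensor m E) Ad is = ?A is + Dual 0 (Ad is)" for "is"
    by (simp add: dual_tensor_def adjacency_tensor_def Dual_add zero_dualnum_def)
  ultimately have "dual_tensor (adjacency_tensor m E) Ad (u # is) * ?P is
      = ?A (u # is) * ?P is + Dual 0 (Ad (u # is) * (\<Prod>j\<leftarrow>is. x $ j))" for "is"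
    by (simp only: distrib_right)
  then have "tensor_apply m (dual_tensor (adjacency_tensor m E) Ad) (dual_vec x y) $ u
      = tensor_apply m ?A (dual_vec x y) $ u + Dual 0 (tensor_apply m Ad x $ u)"
    by (simp add: tensor_apply_def sum.distrib Dual_sum)
  also have "tensor_apply m ?A (dual_vec x y) $ u = link_sum E (dual_vec x y) u"
    using assms by (rule tensor_apply_adjacency) (auto simp: Dual_of_nat Dual_mult one_dualnum_def)
  also have "\<dots> = Dual (link_sum E x u) (\<Sum>v\<in>UNIV - {u}. pair_sum E x u v * y $ v)"
    by (simp add: link_sum_def dual_vec_def Dual_prod Dual_sum sum_link_pair)
  finally show ?thesis by (simp add: Dual_add)
qed

text \<open>Comparison of standard and dual parts: the former is the real eigenvalue equation for
  \<open>x\<close>, the latter its linearization, a linear system for \<open>y\<close>. The theorem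
  uses dual eigenpairs only through this equivalence.\<close>

lemma dual_eigenpair_iff:
  assumes "m \<ge> 2" "uniform_hypergraph m E"
  shows "dual_eigenpair m (dual_tensor (adjacency_tensor m E) Ad) (Dual ls ld) (dual_vec x y) \<longleftrightarrow>
    x \<noteq> 0 \<and> (\<forall>u. link_sum E x u = ls * x $ u ^ (m - 1)) \<and>
    hyper_matrix m E ls x *v y = tensor_apply m Ad x - ld *s vec_power x (m - 1)"
proof -
  let ?M = "hyper_matrix m E ls x" and ?t = "tensor_apply m Ad x"
  let ?P = "\<lambda>u. \<Sum>v\<in>UNIV - {u}. pair_sum E x u v * y $ v"
  have std: "(\<chi> i. std_part (dual_vec x y $ i)) = x"
    by (simp add: dual_vec_def vec_eq_iff)
  have pow: "(Dual ls ld *s vec_power (dual_vec x y) (m - 1)) $ u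
    = Dual (ls * x $ u ^ (m - 1))
        (real (m - 1) * ls * x $ u ^ (m - 2) * y $ u + ld * x $ u ^ (m - 1))" for u
    using assms(1)
    by (simp add: vec_power_def dual_vec_def Dual_power Dual_mult numeral_2_eq_2)
  have "?P u + ?t $ u = real (m - 1) * ls * x $ u ^ (m - 2) * y $ u + ld * x $ u ^ (m - 1)
      \<longleftrightarrow> (?M *v y) $ u = (?t - ld *s vec_power x (m - 1)) $ u" for u
    unfolding hyper_matrix_mult by (simp add: vec_power_def) linarith
  then show ?thesis
    unfolding dual_eigenpair_def std
      vec_eq_iff[of "tensor_apply _ _ (dual_vec _ _)"] vec_eq_iff[of "_ *v _"]
      tensor_apply_dual_adjacency[OF assms(2)] pow dualnum.inject
    by blast
qed

section \<open>Singular Z-matrices and group inverses\<close>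

text \<open>The index maximizes \<open>a j / x $ j\<close>. The multiple of \<open>x\<close> that
  touches \<open>a\<close> from above there drives both eigenvalue bounds and the kernel
  computation.\<close>

lemma max_ratio:
  fixes x :: "real ^ 'n::finite" and a :: "'n \<Rightarrow> real"
  assumes "\<forall>i. x $ i > 0"
  obtains i where "\<And>j. a j \<le> a i / x $ i * x $ j"
proof -
  let ?R = "range (\<lambda>j. a j / x $ j)"
  have "Max ?R \<in> ?R" by (rule Max_in) auto
  then obtain i where "Max ?R = a i / x $ i" by blast
  then have "a j / x $ j \<le> a i / x $ i" for j using Max_ge[of ?R "a j / x $ j"] by auto
  then show ?thesis using that[of i] assms by (simp add: pos_divide_le_eq)
qed

text \<open>In the row where \<open>cmod (v $ i) / x $ i\<close> is largest, the triangle inequality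
  bounds the eigenvalue equation for \<open>v\<close> by a multiple of the one for
  \<open>x\<close>.\<close>

lemma matrix_eigenvalue_bound:
  fixes B :: "real ^ 'n ^ 'n::finite"
  assumes "\<forall>i j. 0 \<le> B $ i $ j" and pos: "\<forall>i. x $ i > 0" and B: "B *v x = s *\<^sub>R x"
    and ev: "ev \<in> matrix_eigenvalues (\<chi> i j. complex_of_real (B $ i $ j))"
  shows "cmod ev \<le> s"
proof -
  obtain v where "v \<noteq> 0" and v: "(\<chi> i j. complex_of_real (B $ i $ j)) *v v = ev *s v"
    using ev by (auto simp: matrix_eigenvalues_def)
  obtain i where i: "cmod (v $ j) \<le> cmod (v $ i) / x $ i * x $ j" for j
    using max_ratio[OF pos, of "\<lambda>j. cmod (v $ j)"] by blast
  let ?t = "cmod (v $ i) / x $ i"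
  have "v $ i \<noteq> 0"
  proof
    assume "v $ i = 0"
    then have "v $ j = 0" for j using i[of j] by simp
    then show False using \<open>v \<noteq> 0\<close> by (simp add: vec_eq_iff)
  qed
  have "ev * v $ i = (\<Sum>j\<in>UNIV. complex_of_real (B $ i $ j) * v $ j)"
    using arg_cong[OF v, of "\<lambda>w. w $ i"] by (simp add: matrix_vector_mult_def)
  then have "cmod ev * cmod (v $ i) \<le> (\<Sum>j\<in>UNIV. cmod (complex_of_real (B $ i $ j) * v $ j))"
    by (metis norm_mult norm_sum)
  also have "\<dots> \<le> (\<Sum>j\<in>UNIV. B $ i $ j * (?t * x $ j))"
    using assms(1) i by (intro sum_mono) (simp only: norm_mult norm_of_real abs_of_nonneg mult_left_mono)
  also have "\<dots> = ?t * (B *v x) $ i"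
    by (simp add: matrix_vector_mult_def sum_distrib_left algebra_simps)
  also have "\<dots> = s * cmod (v $ i)" using pos[rule_format, of i] by (simp add: B)
  finally show ?thesis using \<open>v $ i \<noteq> 0\<close> by simp
qed

text \<open>For \<open>s\<close> large, \<open>B = s I - M\<close> is nonnegative and has the
  positive eigenvector \<open>x\<close> with eigenvalue \<open>s\<close>, so \<open>s\<close> is
  exactly its spectral radius.\<close>

lemma M_matrix_if_positive_kernel:
  fixes M :: "real ^ 'n ^ 'n::finite"
  assumes Z: "Z_matrix M" and pos: "\<forall>i. x $ i > 0" and M: "M *v x = 0"
  shows "M_matrix M"
proof -
  \<comment> \<open>This value dominates every diagonal entry of \<open>M\<close> and is
    nonnegative, hence its own modulus.\<close>
  define s where "s = (\<Sum>i\<in>UNIV. \<bar>M $ i $ i\<bar>)"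
  define B where "B = s *\<^sub>R mat 1 - M"
  have "M $ i $ i \<le> s" for i
    unfolding s_def using member_le_sum[of i UNIV "\<lambda>i. \<bar>M $ i $ i\<bar>"] by simp
  then have B0: "\<forall>i j. 0 \<le> B $ i $ j"
    using Z by (auto simp: B_def Z_matrix_def mat_def)
  have Bx: "B *v x = s *\<^sub>R x"
    by (simp add: B_def matrix_vector_mult_diff_rdistrib M scaleR_matrix_vector_assoc[symmetric])
  let ?x = "(\<chi> i. complex_of_real (x $ i)) :: complex ^ 'n"
  have "?x $ i \<noteq> 0" for i using pos[rule_format, of i] by simp
  then have "?x \<noteq> 0" by (metis zero_index)
  moreover have "(\<chi> i j. complex_of_real (B $ i $ j)) *v ?x = complex_of_real s *s ?x"
  proof (subst vec_eq_iff, rule allI)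
    fix i
    have "(\<Sum>j\<in>UNIV. B $ i $ j * x $ j) = s * x $ i"
      using arg_cong[OF Bx, of "\<lambda>w. w $ i"] by (simp add: matrix_vector_mult_def)
    then show "((\<chi> i j. complex_of_real (B $ i $ j)) *v ?x) $ i = (complex_of_real s *s ?x) $ i"
      by (simp add: matrix_vector_mult_def flip: of_real_mult of_real_sum)
  qed
  ultimately have "complex_of_real s \<in> matrix_eigenvalues (\<chi> i j. complex_of_real (B $ i $ j))"
    by (auto simp: matrix_eigenvalues_def)
  moreover have "0 \<le> s" by (simp add: s_def sum_nonneg)
  ultimately have "is_matrix_spectral_radius B s"
    using matrix_eigenvalue_bound[OF B0 pos Bx]
    by (auto simp: is_matrix_spectral_radius_def is_largest_modulus_def intro!: bexI[of _ "complex_of_real s"])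
  moreover have "M = s *\<^sub>R mat 1 - B" by (simp add: B_def)
  ultimately show ?thesis using Z B0 unfolding M_matrix_def by blast
qed

text \<open>Subtracting a kernel vector \<open>v\<close> from the least multiple of \<open>x\<close>
  above it leaves a nonnegative kernel vector \<open>w\<close> with a zero coordinate. Zeros of
  \<open>w\<close> spread along nonzero entries of \<open>M\<close>, hence everywhere.\<close>

lemma kernel_irreducible_Z_matrix:
  fixes M :: "real ^ 'n ^ 'n::finite"
  assumes Z: "Z_matrix M" and irr: "irreducible_matrix M"
    and pos: "\<forall>i. x $ i > 0" and M: "M *v x = 0"
  shows "{v. M *v v = 0} = {c *\<^sub>R x |c. True}"
proof (intro equalityI subsetI)
  fix v assume "v \<in> {v. M *v v = 0}"
  then have v: "M *v v = 0" by simp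
  obtain i where i: "v $ j \<le> v $ i / x $ i * x $ j" for j
    using max_ratio[OF pos, of "\<lambda>j. v $ j"] by blast
  define w where "w = (v $ i / x $ i) *\<^sub>R x - v"
  have w0: "w $ j \<ge> 0" for j using i[of j] by (simp add: w_def)
  have Mw: "M *v w = 0"
    by (simp add: w_def matrix_vector_mult_diff_distrib matrix_vector_mult_scaleR M v)
  \<comment> \<open>In a row \<open>k\<close> with \<open>w $ k = 0\<close> the diagonal term drops
    out and the others have one sign. Their sum is zero, so each of them is.\<close>
  have step: "w $ l = 0" if "w $ k = 0" "k \<noteq> l" "M $ k $ l \<noteq> 0" for k l
  proof -
    have "(\<Sum>j\<in>UNIV. - (M $ k $ j * w $ j)) = 0"
      using arg_cong[OF Mw, of "\<lambda>z. z $ k"] by (simp add: matrix_vector_mult_def sum_negf)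
    moreover have "0 \<le> - (M $ k $ j * w $ j)" for j
      using Z w0[of j] that(1) by (cases "j = k") (auto simp: Z_matrix_def mult_nonpos_nonneg)
    ultimately have "- (M $ k $ l * w $ l) = 0"
      by (subst (asm) sum_nonneg_eq_0_iff) auto
    then show ?thesis using that by simp
  qed
  have "w $ j = 0" for j
  proof -
    have "(\<lambda>i j. i \<noteq> j \<and> M $ i $ j \<noteq> 0)\<^sup>*\<^sup>* i j" using irr by (simp add: irreducible_matrix_def)
    then show ?thesis
    proof (induction rule: rtranclp_induct)
      case base
      then show ?case using pos[rule_format, of i] by (simp add: w_def)
    qed (use step in blast)
  qed
  then have "v = (v $ i / x $ i) *\<^sub>R x" by (simp add: w_def vec_eq_iff)
  then show "v \<in> {c *\<^sub>R x |c. True}" by blast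
qed (auto simp: matrix_vector_mult_scaleR M)

section \<open>Group inverses of symmetric matrices\<close>

text \<open>First M X = M Y M X = Y M X M = Y M = M Y; then X = X M X = X M Y = M X Y = M Y Y = Y M
  Y = Y.\<close>

lemma group_inverse_unique:
  assumes "is_group_inverse M X" "is_group_inverse M Y"
  shows "X = Y"
proof -
  have X: "M ** X ** M = M" "X ** M ** X = X" "M ** X = X ** M"
    and Y: "M ** Y ** M = M" "Y ** M ** Y = Y" "M ** Y = Y ** M"
    using assms by (auto simp: is_group_inverse_def)
  have e: "M ** X = M ** Y"
    by (metis X(1) X(3) Y(1) Y(3) matrix_mul_assoc)
  then show ?thesis by (metis X(2,3) Y(2,3) matrix_mul_assoc)
qed

lemma inner_symmetric_matrix_kernel:
  fixes M :: "real ^ 'n ^ 'n::finite"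
  assumes "transpose M = M" "M *v x = 0"
  shows "x \<bullet> (M *v v) = 0"
  by (metis assms dot_lmul_matrix inner_zero_left transpose_matrix_vector)

text \<open>Adding x x^T makes \<open>M\<close> invertible without changing it on the orthogonal
  complement of \<open>x\<close>. Removing the action on \<open>x\<close> from the inverse gives
  \<open>X\<close>, and M X = X M is the orthogonal projection onto that complement. The second
  conclusion therefore solves M y = b for every \<open>b\<close> orthogonal to
  \<open>x\<close>.\<close>

lemma symmetric_matrix_group_inverse:
  fixes M :: "real ^ 'n ^ 'n::finite"
  assumes sym: "transpose M = M" and ker: "{v. M *v v = 0} = {c *\<^sub>R x |c. True}" and "x \<noteq> 0"
  obtains X where "is_group_inverse M X"
    and "\<And>v. M *v (X *v v) = v - ((x \<bullet> v) / (x \<bullet> x)) *\<^sub>R x"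
proof -
  let ?a = "x \<bullet> x"
  have a: "?a \<noteq> 0" using \<open>x \<noteq> 0\<close> by simp
  have "1 *\<^sub>R x \<in> {v. M *v v = 0}" unfolding ker by blast
  then have Mx: "M *v x = 0" by simp
  note xM = inner_symmetric_matrix_kernel[OF sym Mx]
  define Q where "Q = (\<chi> i j. x $ i * x $ j)"
  have Q: "Q *v v = (x \<bullet> v) *\<^sub>R x" for v
    by (simp add: Q_def vec_eq_iff matrix_vector_mult_def inner_vec_def sum_distrib_left
        sum_distrib_right mult_ac)
  define N where "N = M + Q"
  have N: "N *v v = M *v v + (x \<bullet> v) *\<^sub>R x" for v
    by (simp add: N_def matrix_vector_mult_add_rdistrib Q)
  have "v = 0" if "N *v v = 0" for v
  proof -
    have "x \<bullet> (N *v v) = (x \<bullet> v) * ?a" by (simp add: N inner_add_right xM)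
    then have "x \<bullet> v = 0" using that a by simp
    then have "M *v v = 0" using that by (simp add: N)
    then obtain c where "v = c *\<^sub>R x" using ker by blast
    then show "v = 0" using \<open>x \<bullet> v = 0\<close> a by simp
  qed
  then obtain N' where N'N: "N' ** N = mat 1"
    using matrix_left_invertible_ker by blast
  then have NN': "N ** N' = mat 1" by (simp add: matrix_left_right_inverse)
  have N'Nv: "N' *v (N *v v) = v" for v using N'N by (simp add: matrix_vector_mul_assoc)
  have NN'v: "N *v (N' *v v) = v" for v using NN' by (simp add: matrix_vector_mul_assoc)
  have "N *v x = ?a *\<^sub>R x" by (simp add: N Mx)
  then have "(1 / ?a) *\<^sub>R (?a *\<^sub>R (N' *v x)) = (1 / ?a) *\<^sub>R x"
    using N'Nv[of x] by (simp add: matrix_vector_mult_scaleR)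
  then have N'x: "N' *v x = (1 / ?a) *\<^sub>R x" using a by simp
  have xN': "x \<bullet> (N' *v v) = (x \<bullet> v) / ?a" for v
  proof -
    have "x \<bullet> v = x \<bullet> (N *v (N' *v v))" by (simp add: NN'v)
    then show ?thesis using a by (simp add: N inner_add_right xM)
  qed
  \<comment> \<open>On \<open>x\<close> the matrix \<open>N'\<close> acts as \<open>1 / ?a\<close>
    and \<open>Q\<close> as \<open>?a\<close>, so this coefficient makes \<open>X\<close> vanish on
    \<open>x\<close>.\<close>
  define X where "X = N' - (1 / ?a ^ 2) *\<^sub>R Q"
  have X: "X *v v = N' *v v - ((x \<bullet> v) / ?a ^ 2) *\<^sub>R x" for v
    by (simp add: X_def matrix_vector_mult_diff_rdistrib scaleR_matrix_vector_assoc[symmetric] Q)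
  have MX: "M *v (X *v v) = v - ((x \<bullet> v) / ?a) *\<^sub>R x" for v
  proof -
    have "M *v (X *v v) = M *v (N' *v v)"
      by (simp add: X matrix_vector_mult_diff_distrib matrix_vector_mult_scaleR Mx)
    also have "\<dots> = v - (x \<bullet> (N' *v v)) *\<^sub>R x"
      using NN'v[of v] by (simp add: N eq_diff_eq)
    finally show ?thesis by (simp add: xN')
  qed
  have XM: "X *v (M *v v) = v - ((x \<bullet> v) / ?a) *\<^sub>R x" for v
  proof -
    have "N' *v (M *v v) = N' *v (N *v v - (x \<bullet> v) *\<^sub>R x)" by (simp add: N)
    also have "\<dots> = v - ((x \<bullet> v) / ?a) *\<^sub>R x"
      by (simp only: matrix_vector_mult_diff_distrib matrix_vector_mult_scaleR N'Nv N'x) simp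
    finally show ?thesis by (simp add: X xM)
  qed
  have xX: "x \<bullet> (X *v v) = 0" for v
    using a by (simp add: X inner_diff_right xN' power2_eq_square)
  have Xx: "X *v x = 0" using a by (simp add: X N'x power2_eq_square)
  have "is_group_inverse M X"
    unfolding is_group_inverse_def matrix_eq
    by (simp add: matrix_vector_mul_assoc[symmetric] MX XM xM xX
        matrix_vector_mult_diff_distrib matrix_vector_mult_scaleR Mx Xx)
  then show ?thesis using that MX by blast
qed

section \<open>Perron eigenvectors of the adjacency tensor\<close>

text \<open>The Lagrangian polynomial of the hypergraph; its partial derivative in
  \<open>x $ u\<close> is \<open>link_sum E x u\<close>.\<close>

definition edge_poly :: "'n set set \<Rightarrow> real ^ 'n \<Rightarrow> real"
  where "edge_poly E x = (\<Sum>e\<in>E. \<Prod>j\<in>e. x $ j)"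

lemma continuous_on_edge_poly: "continuous_on S (edge_poly E :: real ^ 'n::finite \<Rightarrow> real)"
  unfolding edge_poly_def by (intro continuous_intros)

lemma edge_poly_scaleR:
  fixes E :: "'n::finite set set"
  assumes "uniform_hypergraph m E"
  shows "edge_poly E (c *\<^sub>R x) = c ^ m * edge_poly E x"
  using assms by (simp add: edge_poly_def sum_distrib_left prod.distrib uniform_hypergraph_def)

text \<open>An edge contains \<open>u\<close> at most once, so the polynomial is affine in each
  coordinate and the expansion is exact.\<close>

lemma edge_poly_add_axis:
  fixes E :: "'n::finite set set"
  shows "edge_poly E (x + axis u t) = edge_poly E x + t * link_sum E x u"
proof -
  have "(\<Prod>j\<in>e. (x + axis u t) $ j) = (\<Prod>j\<in>e. x $ j) + (if u \<in> e then t * (\<Prod>j\<in>e - {u}. x $ j) else 0)"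
    for e :: "'n set"
  proof (cases "u \<in> e")
    case True
    have "(\<Prod>j\<in>e. (x + axis u t) $ j) = (x $ u + t) * (\<Prod>j\<in>e - {u}. x $ j)"
      using True by (subst prod.remove[of e u]) (auto simp: axis_def intro!: prod.cong)
    moreover have "(\<Prod>j\<in>e. x $ j) = x $ u * (\<Prod>j\<in>e - {u}. x $ j)"
      using True by (subst prod.remove[of e u]) auto
    ultimately show ?thesis using True by (simp add: algebra_simps)
  next
    case False
    then show ?thesis by (auto simp: axis_def intro!: prod.cong)
  qed
  then show ?thesis
    by (simp add: edge_poly_def link_sum_def sum.distrib sum_distrib_left
        sum.inter_filter if_distrib[of "(*) t"] cong: if_cong)
qed

text \<open>A maximum exists by compactness of \<open>K\<close>. Homogeneity then frees the
  inequality from the normalization, so that perturbed vectors can be inserted without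
  rescaling.\<close>

lemma edge_poly_max:
  fixes E :: "'n::finite set set"
  assumes "m \<ge> 1" and unif: "uniform_hypergraph m E" and "E \<noteq> {}"
  obtains x where "\<forall>i. x $ i \<ge> 0" "(\<Sum>i\<in>UNIV. x $ i ^ m) = 1" "edge_poly E x > 0"
    "\<And>y. \<forall>i. y $ i \<ge> 0 \<Longrightarrow> edge_poly E y \<le> edge_poly E x * (\<Sum>i\<in>UNIV. y $ i ^ m)"
proof -
  define K where "K = {x :: real ^ 'n. (\<forall>i. 0 \<le> x $ i) \<and> (\<Sum>i\<in>UNIV. x $ i ^ m) = 1}"
  have "closed K"
    unfolding K_def by (intro closed_Collect_conj closed_Collect_all closed_Collect_le closed_Collect_eq
      continuous_intros)
  moreover have "K \<subseteq> cbox 0 1"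
  proof
    fix x assume x: "x \<in> K"
    have "x $ i \<le> 1" for i
    proof -
      have "x $ i ^ m \<le> (\<Sum>i\<in>UNIV. x $ i ^ m)"
        using x by (intro member_le_sum) (auto simp: K_def)
      then have "x $ i ^ m \<le> 1" using x by (simp add: K_def)
      then show ?thesis using x \<open>m \<ge> 1\<close> by (auto simp: K_def power_le_one_iff)
    qed
    then show "x \<in> cbox 0 1" using x by (simp add: K_def mem_box_cart)
  qed
  ultimately have "compact K"
    using bounded_subset[OF bounded_cbox] by (auto simp: compact_eq_bounded_closed)
  moreover have "K \<noteq> {}"
  proof -
    \<comment> \<open>Here \<open>undefined\<close> merely serves as some vertex.\<close>
    have "axis undefined 1 $ i ^ m = (if i = undefined then 1 else 0 :: real)" for i :: 'n
      using \<open>m \<ge> 1\<close> by (simp add: axis_def)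
    then have "axis undefined 1 \<in> K" by (simp add: K_def) (simp add: axis_def)
    then show ?thesis by blast
  qed
  ultimately obtain x where x: "x \<in> K" and mx: "\<And>y. y \<in> K \<Longrightarrow> edge_poly E y \<le> edge_poly E x"
    using continuous_attains_sup[OF _ _ continuous_on_edge_poly] by metis
  have le: "edge_poly E y \<le> edge_poly E x * (\<Sum>i\<in>UNIV. y $ i ^ m)" if y: "\<forall>i. y $ i \<ge> 0" for y
  proof (cases "y = 0")
    case True
    have "edge_poly E (0 *\<^sub>R x) = 0" unfolding edge_poly_scaleR[OF unif] using \<open>m \<ge> 1\<close> by simp
    then show ?thesis using True \<open>m \<ge> 1\<close> by (simp add: zero_power)
  next
    case False
    let ?S = "\<Sum>i\<in>UNIV. y $ i ^ m"
    obtain i where "y $ i \<noteq> 0" using False by (auto simp: vec_eq_iff)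
    then have "0 < y $ i" using y[rule_format, of i] by simp
    then have "0 < y $ i ^ m" by simp
    also have "\<dots> \<le> ?S" using y by (intro member_le_sum) auto
    finally have S: "?S > 0" .
    define s where "s = root m ?S"
    have s: "s > 0" "s ^ m = ?S" using S \<open>m \<ge> 1\<close> by (auto simp: s_def)
    have "(\<Sum>i\<in>UNIV. (inverse s *\<^sub>R y) $ i ^ m) = inverse (s ^ m) * ?S"
      by (simp add: power_mult_distrib sum_distrib_left power_inverse)
    also have "\<dots> = 1" using s(2) S by simp
    finally have "inverse s *\<^sub>R y \<in> K" using y s(1) by (simp add: K_def)
    then have "inverse s ^ m * edge_poly E y \<le> edge_poly E x"
      unfolding edge_poly_scaleR[OF unif, symmetric] by (rule mx)
    then have "edge_poly E y \<le> edge_poly E x * s ^ m"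
      using s(1) by (simp add: power_inverse field_simps)
    then show ?thesis by (simp only: s(2))
  qed
  \<comment> \<open>At the all-ones vector the polynomial counts the edges, which forces a positive
    maximum.\<close>
  have "0 < edge_poly E 1"
    using \<open>E \<noteq> {}\<close> by (simp add: edge_poly_def card_gt_0_iff)
  also have "\<dots> \<le> edge_poly E x * (\<Sum>i\<in>(UNIV :: 'n set). 1 $ i ^ m)" by (rule le) simp
  finally have "edge_poly E x > 0" by (simp add: zero_less_mult_iff)
  then show ?thesis using x le by (intro that[of x]) (auto simp: K_def)
qed

text \<open>A path from outside \<open>Z\<close> into \<open>Z\<close> has a step that enters
  \<open>Z\<close>, and the edge of that step crosses.\<close>

lemma connected_hypergraph_crossing_edge:
  assumes "connected_hypergraph E" "a \<notin> Z" "b \<in> Z"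
  obtains e u v where "e \<in> E" "u \<in> e" "v \<in> e" "u \<notin> Z" "v \<in> Z"
proof -
  have "(hyper_adj E)\<^sup>*\<^sup>* a b" using assms by (simp add: connected_hypergraph_def)
  then have "b \<in> Z \<longrightarrow> (\<exists>e\<in>E. \<exists>u\<in>e. \<exists>v\<in>e. u \<notin> Z \<and> v \<in> Z)"
  proof (induction rule: rtranclp_induct)
    case base
    then show ?case using \<open>a \<notin> Z\<close> by blast
  next
    case (step y z)
    then show ?case unfolding hyper_adj_def by (cases "y \<in> Z") blast+
  qed
  then show ?thesis using assms that by blast
qed

text \<open>Raising the zero coordinates of x to t costs only O(t^m) in the normalization, but an edge
  meeting both the support and its complement gains at least c t^(m-1).\<close>

lemma edge_poly_maximizer_positive:
  fixes E :: "'n::finite set set"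
  assumes unif: "uniform_hypergraph m E" and "m \<ge> 1" and conn: "connected_hypergraph E"
    and x0: "\<forall>i. x $ i \<ge> 0" and x1: "(\<Sum>i\<in>UNIV. x $ i ^ m) = 1" and "edge_poly E x > 0"
    and max: "\<And>y. \<forall>i. y $ i \<ge> 0 \<Longrightarrow> edge_poly E y \<le> edge_poly E x * (\<Sum>i\<in>UNIV. y $ i ^ m)"
  shows "x $ i > 0"
proof (rule ccontr)
  assume "\<not> x $ i > 0"
  define Z where "Z = {j. x $ j = 0}"
  define F where "F = edge_poly E x"
  have i: "i \<in> Z" using \<open>\<not> x $ i > 0\<close> x0[rule_format, of i] by (simp add: Z_def)
  have "\<exists>k. k \<notin> Z"
  proof (rule ccontr)
    assume "\<nexists>k. k \<notin> Z"
    then show False using x1 \<open>m \<ge> 1\<close> by (simp add: Z_def zero_power)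
  qed
  then obtain e u v where e: "e \<in> E" "u \<in> e" "v \<in> e" "u \<notin> Z" "v \<in> Z"
    using connected_hypergraph_crossing_edge[OF conn _ i] by metis
  define c where "c = (\<Prod>j\<in>e - Z. x $ j)"
  have "c > 0" unfolding c_def using x0 by (intro prod_pos) (auto simp: Z_def order_less_le)
  have bound: "c \<le> F * card Z * t" if t: "0 < t" "t \<le> 1" for t
  proof -
    define y where "y = (\<chi> j. if j \<in> Z then t else x $ j)"
    have y0: "\<forall>j. 0 \<le> y $ j" and xy: "x $ j \<le> y $ j" for j
      using x0 t by (auto simp: y_def Z_def)
    have "card e = m" using unif e by (simp add: uniform_hypergraph_def)
    moreover have "card (e \<inter> Z) < card e" using e by (intro psubset_card_mono) auto
    \<comment> \<open>The vertex \<open>u\<close> of \<open>e\<close> lies outside \<open>Z\<close>,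
      so at most \<open>m - 1\<close> factors are raised to \<open>t\<close>; as
      \<open>t \<le> 1\<close>, the edge contributes at least
      \<open>c * t ^ (m - 1)\<close>.\<close>
    ultimately have card: "card (e \<inter> Z) \<le> m - 1" by simp
    have "(\<Prod>j\<in>e. y $ j) = (\<Prod>j\<in>e \<inter> Z. y $ j) * (\<Prod>j\<in>e - Z. y $ j)"
      by (metis finite prod.Int_Diff)
    also have "\<dots> = t ^ card (e \<inter> Z) * c" by (simp add: y_def c_def)
    finally have ye: "c * t ^ (m - 1) \<le> (\<Prod>j\<in>e. y $ j)"
      using power_decreasing[OF card, of t] t \<open>c > 0\<close> by (simp add: mult.commute)
    \<comment> \<open>The vertex \<open>v\<close> makes the old contribution of \<open>e\<close>
      vanish, so its new value is pure gain.\<close>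
    have xe: "(\<Prod>j\<in>e. x $ j) = 0" using e by (auto simp: Z_def)
    have "F = (\<Sum>e\<in>E - {e}. \<Prod>j\<in>e. x $ j)"
      using e by (simp add: F_def edge_poly_def sum.remove xe)
    also have "\<dots> \<le> (\<Sum>e\<in>E - {e}. \<Prod>j\<in>e. y $ j)"
      using x0 xy by (intro sum_mono prod_mono) auto
    finally have "F + c * t ^ (m - 1) \<le> edge_poly E y"
      using ye e by (simp add: edge_poly_def sum.remove)
    also have "\<dots> \<le> F * (\<Sum>j\<in>UNIV. y $ j ^ m)" unfolding F_def by (rule max[OF y0])
    also have "(\<Sum>j\<in>UNIV. y $ j ^ m) = (\<Sum>j\<in>UNIV. x $ j ^ m + (if j \<in> Z then t ^ m else 0))"
      using \<open>m \<ge> 1\<close> by (intro sum.cong) (auto simp: y_def Z_def)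
    also have "\<dots> = 1 + card Z * t ^ m"
      by (simp add: sum.distrib x1 flip: sum.inter_filter)
    also have "t ^ m = t * t ^ (m - 1)" using \<open>m \<ge> 1\<close> by (simp add: power_eq_if)
    finally have "c * t ^ (m - 1) \<le> (F * card Z * t) * t ^ (m - 1)" by (simp add: algebra_simps)
    then show ?thesis using t by (simp add: mult_le_cancel_right)
  qed
  \<comment> \<open>Chosen so that \<open>bound\<close> would give \<open>c \<le> c / 2\<close>; the
    minimum with 1 keeps \<open>t\<close> in the range where \<open>bound\<close> applies.\<close>
  define t where "t = min 1 (c / (2 * (F * card Z)))"
  have "card Z > 0" using i by (auto simp: card_gt_0_iff)
  then have FZ: "F * card Z > 0" using assms(6) by (simp add: F_def)
  then have "t > 0" "t \<le> 1" using \<open>c > 0\<close> by (auto simp: t_def)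
  then have "c \<le> F * card Z * t" by (rule bound)
  also have "\<dots> \<le> F * card Z * (c / (2 * (F * card Z)))"
    using FZ by (intro mult_left_mono) (auto simp: t_def)
  also have "\<dots> = c / 2" using less_imp_neq[OF FZ] by simp
  finally show False using \<open>c > 0\<close> by simp
qed

text \<open>The Lagrange condition at the maximizer, read off one coordinate at a time; the
  multiplier is \<open>m\<close> times the maximum.\<close>

lemma positive_eigenvector_exists:
  fixes E :: "'n::finite set set"
  assumes "m \<ge> 1" and unif: "uniform_hypergraph m E" and conn: "connected_hypergraph E" and "E \<noteq> {}"
  obtains l :: real and x :: "real ^ 'n" where "l > 0" "\<forall>i. x $ i > 0" "\<forall>u. link_sum E x u = l * x $ u ^ (m - 1)"
proof -
  obtain x where x0: "\<forall>i. x $ i \<ge> 0" and x1: "(\<Sum>i\<in>UNIV. x $ i ^ m) = 1"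
    and F: "edge_poly E x > 0"
    and mx: "\<And>y. \<forall>i. y $ i \<ge> 0 \<Longrightarrow> edge_poly E y \<le> edge_poly E x * (\<Sum>i\<in>UNIV. y $ i ^ m)"
    using edge_poly_max[OF \<open>m \<ge> 1\<close> unif \<open>E \<noteq> {}\<close>] by metis
  have pos: "x $ i > 0" for i
    by (rule edge_poly_maximizer_positive[OF unif \<open>m \<ge> 1\<close> conn x0 x1 F mx])
  let ?F = "edge_poly E x"
  have "link_sum E x u = (real m * ?F) * x $ u ^ (m - 1)" for u
  proof -
    \<comment> \<open>The slack of the maximality inequality at \<open>x + axis u t\<close>. It
      vanishes at 0 and is nonnegative nearby, for both signs of \<open>t\<close> because
      \<open>x $ u > 0\<close>.\<close>
    define h where "h t = ?F * ((x $ u + t) ^ m - x $ u ^ m) - t * link_sum E x u" for t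
    have "(h has_real_derivative ?F * (real m * x $ u ^ (m - 1)) - link_sum E x u) (at 0)"
      unfolding h_def by (auto intro!: derivative_eq_intros)
    moreover have "h 0 \<le> h t" if "\<bar>0 - t\<bar> < x $ u" for t
    proof -
      let ?y = "x + axis u t"
      have "\<forall>i. ?y $ i \<ge> 0" using x0 that by (auto simp: axis_def)
      then have "?F + t * link_sum E x u \<le> ?F * (\<Sum>i\<in>UNIV. ?y $ i ^ m)"
        using mx edge_poly_add_axis by metis
      moreover have "(\<Sum>i\<in>UNIV. ?y $ i ^ m)
          = (\<Sum>i\<in>UNIV. x $ i ^ m + (if i = u then (x $ u + t) ^ m - x $ u ^ m else 0))"
        by (intro sum.cong) (auto simp: axis_def)
      moreover have "\<dots> = 1 + ((x $ u + t) ^ m - x $ u ^ m)"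
        by (simp add: sum.distrib x1)
      ultimately have "?F + t * link_sum E x u \<le> ?F * (1 + ((x $ u + t) ^ m - x $ u ^ m))"
        by (simp only:)
      then show ?thesis by (simp add: h_def algebra_simps)
    qed
    ultimately have "?F * (real m * x $ u ^ (m - 1)) - link_sum E x u = 0"
      using DERIV_local_min[of h _ 0 "x $ u"] pos by blast
    then show ?thesis by (simp add: mult_ac)
  qed
  then show ?thesis using that[of "real m * ?F" x] pos F \<open>m \<ge> 1\<close> by simp
qed

section \<open>The spectral radius of the adjacency tensor\<close>

text \<open>The comparison at the largest ratio again. Each edge at \<open>i\<close> has
  \<open>m - 1\<close> other vertices, so the ratio enters with the power \<open>m - 1\<close>,
  matching the right-hand side of the eigenvalue equation.\<close>

lemma tensor_eigenvalue_bound: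
  fixes E :: "'n::finite set set"
  assumes unif: "uniform_hypergraph m E" and pos: "\<forall>i. x $ i > 0"
    and x: "\<forall>u. link_sum E x u = l * x $ u ^ (m - 1)"
    and "z \<noteq> 0" and z: "\<forall>u. link_sum E z u = (ev :: complex) * z $ u ^ (m - 1)"
  shows "cmod ev \<le> l"
proof -
  obtain i where i: "cmod (z $ j) \<le> cmod (z $ i) / x $ i * x $ j" for j
    using max_ratio[OF pos, of "\<lambda>j. cmod (z $ j)"] by blast
  let ?t = "cmod (z $ i) / x $ i"
  have "z $ i \<noteq> 0"
  proof
    assume "z $ i = 0"
    then have "z $ j = 0" for j using i[of j] by simp
    then show False using \<open>z \<noteq> 0\<close> by (simp add: vec_eq_iff)
  qed
  have "cmod ev * cmod (z $ i) ^ (m - 1) = cmod (link_sum E z i)"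
    by (simp add: z norm_mult norm_power)
  also have "\<dots> \<le> (\<Sum>e | e \<in> E \<and> i \<in> e. \<Prod>j\<in>e - {i}. cmod (z $ j))"
    unfolding link_sum_def by (rule order_trans[OF norm_sum]) (simp add: prod_norm)
  also have "\<dots> \<le> (\<Sum>e | e \<in> E \<and> i \<in> e. \<Prod>j\<in>e - {i}. ?t * x $ j)"
    using i by (intro sum_mono prod_mono) simp
  also have "\<dots> = (\<Sum>e | e \<in> E \<and> i \<in> e. ?t ^ (m - 1) * (\<Prod>j\<in>e - {i}. x $ j))"
    using unif by (intro sum.cong refl)
      (auto simp only: prod.distrib uniform_hypergraph_def prod_constant card_Diff_singleton mem_Collect_eq)
  also have "\<dots> = ?t ^ (m - 1) * link_sum E x i"
    by (simp add: link_sum_def sum_distrib_left)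
  also have "\<dots> = l * cmod (z $ i) ^ (m - 1)"
    using pos[rule_format, of i] by (simp add: x power_divide)
  finally show ?thesis using \<open>z $ i \<noteq> 0\<close> by simp
qed

lemma adjacency_tensor_spectral_radius:
  fixes E :: "'n::finite set set"
  assumes unif: "uniform_hypergraph m E" and "l > 0" and pos: "\<forall>i. x $ i > 0"
    and x: "\<forall>u. link_sum E x u = l * x $ u ^ (m - 1)"
  shows "is_tensor_spectral_radius m (adjacency_tensor m E) l"
proof -
  let ?A = "\<lambda>is. complex_of_real (adjacency_tensor m E is)"
  have A: "tensor_apply m ?A z = ev *s vec_power z (m - 1)
      \<longleftrightarrow> (\<forall>u. link_sum E z u = ev * z $ u ^ (m - 1))" for z ev
  proof -
    have "tensor_apply m ?A z $ u = link_sum E z u" for u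
      using unif by (rule tensor_apply_adjacency[where c = "1 / fact (m - 1)"])
        (auto simp: adjacency_tensor_def)
    then show ?thesis by (simp add: vec_eq_iff vec_power_def)
  qed
  let ?x = "(\<chi> i. complex_of_real (x $ i)) :: complex ^ 'n"
  have "?x $ i \<noteq> 0" for i using pos[rule_format, of i] by simp
  then have "?x \<noteq> 0" by (metis zero_index)
  moreover have "link_sum E ?x u = complex_of_real l * ?x $ u ^ (m - 1)" for u
  proof -
    have "link_sum E ?x u = complex_of_real (link_sum E x u)" by (simp add: link_sum_def)
    then show ?thesis by (simp add: x)
  qed
  ultimately have "complex_of_real l \<in> tensor_eigenvalues m ?A"
    unfolding tensor_eigenvalues_def mem_Collect_eq A by blast
  moreover have "cmod ev \<le> l" if "ev \<in> tensor_eigenvalues m ?A" for ev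
    using that tensor_eigenvalue_bound[OF unif pos x]
    unfolding tensor_eigenvalues_def mem_Collect_eq A by blast
  moreover have "cmod (complex_of_real l) = l" using \<open>l > 0\<close> by simp
  ultimately show ?thesis
    unfolding is_tensor_spectral_radius_def is_largest_modulus_def by blast
qed

section \<open>The matrix of a hypergraph\<close>

lemma pair_sum_commute: "pair_sum E x u v = pair_sum E x v u"
  by (simp add: pair_sum_def insert_commute)

lemma transpose_hyper_matrix: "transpose (hyper_matrix m E ls x) = hyper_matrix m E ls x"
proof -
  have "hyper_matrix m E ls x $ v $ u = hyper_matrix m E ls x $ u $ v" for u v
    by (cases "u = v") (auto simp: hyper_matrix_off_diagonal pair_sum_commute)
  then show ?thesis by (simp add: transpose_def vec_eq_iff)
qed

lemma Z_matrix_hyper_matrix: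
  assumes "\<forall>i. x $ i > 0"
  shows "Z_matrix (hyper_matrix m E ls x)"
  using assms by (auto simp: Z_matrix_def hyper_matrix_off_diagonal pair_sum_def less_imp_le
      intro!: sum_nonneg prod_nonneg)

text \<open>Adjacent vertices share an edge, whose product is positive, so the digraph of the matrix
  contains \<open>hyper_adj E\<close>.\<close>

lemma irreducible_hyper_matrix:
  fixes E :: "'n::finite set set"
  assumes pos: "\<forall>i. x $ i > 0" and conn: "connected_hypergraph E"
  shows "irreducible_matrix (hyper_matrix m E ls x)"
proof -
  have "u \<noteq> v \<and> hyper_matrix m E ls x $ u $ v \<noteq> 0" if "hyper_adj E u v" for u v
  proof -
    have "u \<noteq> v" "{e \<in> E. {u, v} \<subseteq> e} \<noteq> {}" using that by (auto simp: hyper_adj_def)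
    then have "pair_sum E x u v > 0"
      unfolding pair_sum_def using pos by (intro sum_pos prod_pos) auto
    then show ?thesis using \<open>u \<noteq> v\<close> by (simp add: hyper_matrix_off_diagonal)
  qed
  then have "hyper_adj E \<le> (\<lambda>u v. u \<noteq> v \<and> hyper_matrix m E ls x $ u $ v \<noteq> 0)" by blast
  then show ?thesis
    using conn rtranclp_mono unfolding irreducible_matrix_def connected_hypergraph_def by blast
qed

text \<open>Each edge at u contributes the product over e - {u} once for every v in e - {u},
  hence m - 1 times.\<close>

lemma hyper_matrix_mult_eigenvector:
  fixes E :: "'n::finite set set"
  assumes "m \<ge> 2" and unif: "uniform_hypergraph m E"
    and x: "\<forall>u. link_sum E x u = ls * x $ u ^ (m - 1)"
  shows "hyper_matrix m E ls x *v x = 0"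
proof (subst vec_eq_iff, rule allI)
  fix u
  have "(\<Sum>v\<in>UNIV - {u}. pair_sum E x u v * x $ v)
      = (\<Sum>e | e \<in> E \<and> u \<in> e. \<Sum>v\<in>e - {u}. x $ v * (\<Prod>j\<in>e - {u} - {v}. x $ j))"
    by (rule sum_link_pair[symmetric])
  also have "\<dots> = (\<Sum>e | e \<in> E \<and> u \<in> e. real (m - 1) * (\<Prod>j\<in>e - {u}. x $ j))"
  proof (rule sum.cong[OF refl])
    fix e assume e: "e \<in> {e. e \<in> E \<and> u \<in> e}"
    have "x $ v * (\<Prod>j\<in>e - {u} - {v}. x $ j) = (\<Prod>j\<in>e - {u}. x $ j)" if "v \<in> e - {u}" for v
      using prod.remove[OF _ that, of "\<lambda>j. x $ j"] by simp
    then have "(\<Sum>v\<in>e - {u}. x $ v * (\<Prod>j\<in>e - {u} - {v}. x $ j))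
        = real (card (e - {u})) * (\<Prod>j\<in>e - {u}. x $ j)"
      by simp
    also have "card (e - {u}) = m - 1" using e unif by (simp add: uniform_hypergraph_def)
    finally show "(\<Sum>v\<in>e - {u}. x $ v * (\<Prod>j\<in>e - {u} - {v}. x $ j))
        = real (m - 1) * (\<Prod>j\<in>e - {u}. x $ j)" .
  qed
  also have "\<dots> = real (m - 1) * (ls * x $ u ^ (m - 1))"
    by (simp only: sum_distrib_left[symmetric] link_sum_def[symmetric] x[rule_format])
  also have "x $ u ^ (m - 1) = x $ u ^ (m - 2) * x $ u"
  proof -
    have "m - 1 = Suc (m - 2)" using \<open>m \<ge> 2\<close> by simp
    then show ?thesis by (simp only: power_Suc2)
  qed
  finally show "(hyper_matrix m E ls x *v x) $ u = 0 $ u"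
    by (simp add: hyper_matrix_mult)
qed

text \<open>Needed when the linear system is paired with \<open>x\<close>: it supplies the
  denominator of the formula for the dual part of the eigenvalue.\<close>

lemma inner_vec_power:
  assumes "m \<ge> 1" "\<forall>i. x $ i > 0"
  shows "x \<bullet> vec_power x (m - 1) = m_norm m x ^ m" "m_norm m x \<noteq> 0"
proof -
  have "m_norm m x ^ m = (\<Sum>i\<in>UNIV. \<bar>x $ i\<bar> ^ m)"
    using assms(1) by (simp add: m_norm_def real_root_pow_pos2 sum_nonneg)
  also have "\<dots> = (\<Sum>i\<in>UNIV. x $ i ^ m)" using assms(2) by (simp add: less_imp_le)
  finally have m: "m_norm m x ^ m = (\<Sum>i\<in>UNIV. x $ i ^ m)" .
  have "x $ i * x $ i ^ (m - 1) = x $ i ^ m" for i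
    using assms(1) by (simp add: power_eq_if)
  then show "x \<bullet> vec_power x (m - 1) = m_norm m x ^ m"
    by (simp add: m inner_vec_def vec_power_def)
  have "m_norm m x ^ m > 0" unfolding m using assms(2) by (intro sum_pos) auto
  then show "m_norm m x \<noteq> 0" using assms(1) by (auto simp: zero_power)
qed

lemma kernel_hyper_matrix:
  fixes E :: "'n::finite set set"
  assumes "m \<ge> 2" "uniform_hypergraph m E" "connected_hypergraph E"
    and "\<forall>i. x $ i > 0" "\<forall>u. link_sum E x u = ls * x $ u ^ (m - 1)"
  shows "{v. hyper_matrix m E ls x *v v = 0} = {c *\<^sub>R x |c. True}"
  using assms by (intro kernel_irreducible_Z_matrix Z_matrix_hyper_matrix irreducible_hyper_matrix
      hyper_matrix_mult_eigenvector)

section \<open>Existence of a positive eigenpair and its properties\<close>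

theorem theorem4p1:
  fixes m :: nat and E :: "'n::finite set set"
    and As Ad :: "(real, 'n) tensor" and A :: "(dualnum, 'n) tensor"
  assumes "m \<ge> 2"
    and "uniform_hypergraph m E" and "connected_hypergraph E" and "E \<noteq> {}"
    and "As = adjacency_tensor m E" and "A = dual_tensor As Ad"
  shows "(\<exists>ev x. dual_pos ev \<and> dual_vec_pos x \<and> dual_eigenpair m A ev x) \<and>
    (\<forall>ls ld xs xd.
      dual_pos (Dual ls ld) \<and> dual_vec_pos (dual_vec xs xd) \<and>
      dual_eigenpair m A (Dual ls ld) (dual_vec xs xd) \<longrightarrow>
      (let M = hyper_matrix m E ls xs;
           b = tensor_apply m (\<lambda>is. Ad is - ld * unit_tensor is) xs;
           S = (\<lambda>M1. {M1 *v b + c *\<^sub>R xs |c. True})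
       in
        (is_tensor_spectral_radius m As ls \<and>
         tensor_apply m As xs = ls *s vec_power xs (m - 1) \<and>
         ld = (xs \<bullet> tensor_apply m Ad xs) / m_norm m xs ^ m) \<and>
        (irreducible_matrix M \<and> \<not> invertible M \<and> M_matrix M \<and>
         {v. M *v v = 0} = {c *\<^sub>R xs |c. True}) \<and>
        (\<forall>M1. is_one_inverse M M1 \<longrightarrow>
           xd \<in> S M1 \<and>
           (\<forall>z \<in> S M1. dual_eigenpair m A (Dual ls ld) (dual_vec xs z))) \<and>
        ((\<exists>!X. is_group_inverse M X) \<and>
         (xs \<bullet> xd = 0 \<longrightarrow> xd = group_inverse M *v b))))"
proof -
  note m = assms(1) and unif = assms(2) and conn = assms(3) and As = assms(5)
  have A: "A = dual_tensor (adjacency_tensor m E) Ad" using assms(5,6) by simp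
  have dual_vec_pos: "dual_vec_pos (dual_vec x y) \<longleftrightarrow> (\<forall>i. x $ i > 0)" for x y :: "real ^ 'n"
    by (simp add: dual_vec_pos_def dual_vec_def)
  have nonzero: "x \<noteq> 0" if "\<forall>i. x $ i > 0" for x :: "real ^ 'n"
    using that by (metis less_irrefl zero_index)
  have existence: "\<exists>ev x. dual_pos ev \<and> dual_vec_pos x \<and> dual_eigenpair m A ev x"
  proof -
    obtain l :: real and x :: "real ^ 'n" where "l > 0" and pos: "\<forall>i. x $ i > 0"
      and x: "\<forall>u. link_sum E x u = l * x $ u ^ (m - 1)"
      using positive_eigenvector_exists[OF _ unif conn assms(4)] m by auto
    let ?M = "hyper_matrix m E l x"
    obtain X where X: "?M *v (X *v v) = v - ((x \<bullet> v) / (x \<bullet> x)) *\<^sub>R x" for v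
      using symmetric_matrix_group_inverse[OF transpose_hyper_matrix
          kernel_hyper_matrix[OF m unif conn pos x] nonzero[OF pos]] by blast
    \<comment> \<open>The one value for which \<open>b\<close> is orthogonal to \<open>x\<close>,
      that is, for which the system \<open>?M *v y = b\<close> is solvable.\<close>
    define d where "d = (x \<bullet> tensor_apply m Ad x) / m_norm m x ^ m"
    define b where "b = tensor_apply m Ad x - d *s vec_power x (m - 1)"
    have "d * m_norm m x ^ m = x \<bullet> tensor_apply m Ad x"
      using inner_vec_power(2)[OF _ pos, of m] m by (simp add: d_def)
    then have "x \<bullet> b = 0"
      using inner_vec_power(1)[OF _ pos, of m] m
      by (simp add: b_def inner_diff_right scalar_mult_eq_scaleR)
    then have "?M *v (X *v b) = b" by (simp add: X)
    then have "dual_eigenpair m A (Dual l d) (dual_vec x (X *v b))"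
      unfolding A dual_eigenpair_iff[OF m unif] using x nonzero[OF pos] by (simp add: b_def)
    then show ?thesis using \<open>l > 0\<close> pos dual_vec_pos by (metis dual_pos_def dualnum.sel(1))
  qed
  show ?thesis
  proof (intro conjI[OF existence] allI impI, elim conjE)
    fix ls ld xs xd
    assume "dual_pos (Dual ls ld)" "dual_vec_pos (dual_vec xs xd)"
      and eig: "dual_eigenpair m A (Dual ls ld) (dual_vec xs xd)"
    then have ls: "ls > 0" and pos: "\<forall>i. xs $ i > 0"
      by (simp_all add: dual_pos_def dual_vec_pos)
    define M where "M = hyper_matrix m E ls xs"
    define b where "b = tensor_apply m (\<lambda>is. Ad is - ld * unit_tensor is) xs"
    have b: "b = tensor_apply m Ad xs - ld *s vec_power xs (m - 1)"
      by (simp add: b_def tensor_apply_diff_scaled tensor_apply_unit_tensor)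
    have x: "\<forall>u. link_sum E xs u = ls * xs $ u ^ (m - 1)" and Mxd: "M *v xd = b"
      using eig unfolding A dual_eigenpair_iff[OF m unif] b M_def by auto
    have eig_iff: "dual_eigenpair m A (Dual ls ld) (dual_vec xs z) \<longleftrightarrow> M *v z = b" for z
      unfolding A dual_eigenpair_iff[OF m unif] b M_def using x nonzero[OF pos] by simp
    have Mx: "M *v xs = 0"
      unfolding M_def by (rule hyper_matrix_mult_eigenvector[OF m unif x])
    have ker: "{v. M *v v = 0} = {c *\<^sub>R xs |c. True}"
      unfolding M_def by (rule kernel_hyper_matrix[OF m unif conn pos x])
    have sym: "transpose M = M" unfolding M_def by (rule transpose_hyper_matrix)
    note xM = inner_symmetric_matrix_kernel[OF sym Mx]
    have Asx: "tensor_apply m As xs = ls *s vec_power xs (m - 1)"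
      by (simp add: vec_eq_iff As tensor_apply_adjacency_real[OF unif] x vec_power_def)
    have radius: "is_tensor_spectral_radius m As ls"
      unfolding As by (rule adjacency_tensor_spectral_radius[OF unif ls pos x])
    \<comment> \<open>Pairing \<open>M *v xd = b\<close> with \<open>xs\<close> kills the left side,
      because \<open>M\<close> is symmetric and annihilates \<open>xs\<close>.\<close>
    have "xs \<bullet> tensor_apply m Ad xs = ld * m_norm m xs ^ m"
      using xM[of xd] inner_vec_power[OF _ pos, of m] m
      by (simp add: Mxd b inner_diff_right scalar_mult_eq_scaleR)
    then have ld: "ld = (xs \<bullet> tensor_apply m Ad xs) / m_norm m xs ^ m"
      using inner_vec_power(2)[OF _ pos, of m] m by simp
    have sing: "\<not> invertible M"
      using Mx nonzero[OF pos] matrix_left_invertible_ker[of M]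
      by (auto simp: invertible_left_inverse)
    have Mmat: "M_matrix M"
      using M_matrix_if_positive_kernel[OF _ pos Mx] Z_matrix_hyper_matrix[OF pos]
      by (simp add: M_def)
    have irr: "irreducible_matrix M" unfolding M_def by (rule irreducible_hyper_matrix[OF pos conn])
    have one: "xd \<in> {M1 *v b + c *\<^sub>R xs |c. True} \<and>
        (\<forall>z\<in>{M1 *v b + c *\<^sub>R xs |c. True}. dual_eigenpair m A (Dual ls ld) (dual_vec xs z))"
      if "is_one_inverse M M1" for M1
    proof -
      have "M ** M1 ** M = M" using that by (simp add: is_one_inverse_def)
      \<comment> \<open>As \<open>b = M *v xd\<close> lies in the range of \<open>M\<close>, any
        {1}-inverse yields a particular solution; the kernel accounts for the rest.\<close>
      then have "M *v (M1 *v (M *v xd)) = M *v xd" by (metis matrix_vector_mul_assoc)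
      then have Mb: "M *v (M1 *v b) = b" by (simp add: Mxd)
      then have "xd - M1 *v b \<in> {v. M *v v = 0}"
        by (simp add: matrix_vector_mult_diff_distrib Mxd)
      then obtain c where "xd - M1 *v b = c *\<^sub>R xs" unfolding ker by blast
      then have "xd = M1 *v b + c *\<^sub>R xs" by (simp add: algebra_simps)
      moreover have "M *v (M1 *v b + c *\<^sub>R xs) = b" for c
        by (simp add: matrix_vector_right_distrib matrix_vector_mult_scaleR Mb Mx)
      ultimately show ?thesis unfolding eig_iff by blast
    qed
    obtain X where X: "is_group_inverse M X"
      and MX: "M *v (X *v v) = v - ((xs \<bullet> v) / (xs \<bullet> xs)) *\<^sub>R xs" for v
      using symmetric_matrix_group_inverse[OF sym ker nonzero[OF pos]] by blast
    have ex1: "\<exists>!X. is_group_inverse M X" using X group_inverse_unique by blast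
    have "group_inverse M = X"
      unfolding group_inverse_def using X group_inverse_unique by blast
    \<comment> \<open>Commuting \<open>X\<close> past \<open>M\<close> turns \<open>X *v b\<close>
      into the projection of \<open>xd\<close> off \<open>xs\<close>, which is \<open>xd\<close>
      itself when the two are orthogonal.\<close>
    moreover have "X *v b = M *v (X *v xd)"
      using X by (simp add: Mxd[symmetric] is_group_inverse_def matrix_vector_mul_assoc)
    ultimately have grp: "xd = group_inverse M *v b" if "xs \<bullet> xd = 0"
      using that by (simp add: MX)
    show "let M = hyper_matrix m E ls xs;
           b = tensor_apply m (\<lambda>is. Ad is - ld * unit_tensor is) xs;
           S = (\<lambda>M1. {M1 *v b + c *\<^sub>R xs |c. True})
       in
        (is_tensor_spectral_radius m As ls \<and>
         tensor_apply m As xs = ls *s vec_power xs (m - 1) \<and>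
         ld = (xs \<bullet> tensor_apply m Ad xs) / m_norm m xs ^ m) \<and>
        (irreducible_matrix M \<and> \<not> invertible M \<and> M_matrix M \<and>
         {v. M *v v = 0} = {c *\<^sub>R xs |c. True}) \<and>
        (\<forall>M1. is_one_inverse M M1 \<longrightarrow>
           xd \<in> S M1 \<and>
           (\<forall>z \<in> S M1. dual_eigenpair m A (Dual ls ld) (dual_vec xs z))) \<and>
        ((\<exists>!X. is_group_inverse M X) \<and>
         (xs \<bullet> xd = 0 \<longrightarrow> xd = group_inverse M *v b))"
      unfolding Let_def M_def[symmetric] b_def[symmetric]
      by (intro conjI allI impI radius Asx ld irr sing Mmat ker one[THEN conjunct1]
          one[THEN conjunct2] ex1 grp) assumption+
  qed
qed

end
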